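(* Let $\mathcal{K}(\mathbb{M}_2)\cong\mathbb{R}^6$ be the space of Killing $2$-tensors of the Minkowski plane with coordinates $(A,B,C,\alpha,\beta,\gamma)$, and let $G_M$, $R_0$, $S_1$, $S_3$ be as defined in the context. The set $S_3\setminus S_1$ has two connected components, mapped one into the other by $R_0$, and so it forms a unique orbit of the action of $G_M$.
   Context: In the Minkowski plane $\mathbb{M}_2$ with pseudo-Cartesian coordinates $(t,x)$ and metric $\mathbf{g}$ with contravariant components $\mathrm{diag}(1,-1)$, the general Killing $2$-tensor has contravariant components $K^{11}=A+2\alpha x+\gamma x^2$, $K^{12}=K^{21}=C+\alpha t+\beta x+\gamma tx$, $K^{22}=B+2\beta t+\gamma t^2$, with $A,B,C,\alpha,\beta,\gamma\in\mathbb{R}$. So the vector space $\mathcal{K}(\mathbb{M}_2)$ of Killing $2$-tensors is identified with $\mathbb{R}^6$ with coordinates $(A,B,C,\alpha,\beta,\gamma)$. With respect to $(\partial_A,\partial_B,\partial_C,\partial_\alpha,\partial_\beta,\partial_\gamma)$ define the vector fields on $\mathcal{K}(\mathbb{M}_2)$: $V_1=(0,-2\beta,-\alpha,0,-\gamma,0)$ and $V_2=(-2\alpha,0,-\beta,-\gamma,0,0)$ (translations); $V_3=(2C,2C,A+B,\beta,\alpha,0)$ (boost); $V_4=(2A,2B,2C,\alpha,\beta,0)$ (dilatation of the plane); $V_5=(1,-1,0,0,0,0)$ (addition of a multiple of the metric); $V_6=(A,B,C,\alpha,\beta,\gamma)$ (scalar multiplication). Discrete transformations of $\mathcal{K}(\mathbb{M}_2)$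 (unlisted coordinates are unchanged): $R_0:\mathbf{K}\mapsto-\mathbf{K}$; $R_1: C\mapsto-C,\ \alpha\mapsto-\alpha$; $R_2: C\mapsto-C,\ \beta\mapsto-\beta$. $G_M$ is the group of transformations of $\mathcal{K}(\mathbb{M}_2)$ generated by the flows of $V_1,\dots,V_6$ and by $R_0,R_1,R_2$. $S_1=\{\gamma=0\}$; $S_3=\{\gamma(A+B)=\alpha^2+\beta^2,\ \gamma C=\alpha\beta\}$. *)

theory Defs
  imports "HOL-Analysis.Analysis" "HOL-Algebra.Group_Action"
    "HOL-Algebra.Generated_Groups"
begin

text \<open>
  A Killing 2-tensor of the Minkowski plane, with contravariant components
  \<open>K\<^sup>1\<^sup>1 = A + 2 \<alpha> x + \<gamma> x\<^sup>2\<close>, \<open>K\<^sup>1\<^sup>2 = K\<^sup>2\<^sup>1 = C + \<alpha> t + \<beta> x + \<gamma> t x\<close>,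
  \<open>K\<^sup>2\<^sup>2 = B + 2 \<beta> t + \<gamma> t\<^sup>2\<close> in pseudo-Cartesian coordinates \<open>(t, x)\<close>, is represented by its
  parameters in the order \<open>(A, B, C, \<alpha>, \<beta>, \<gamma>)\<close>.
\<close>

type_synonym killing = "real \<times> real \<times> real \<times> real \<times> real \<times> real"

text \<open>
  \<open>V1\<close> and \<open>V2\<close> come from the translations of the plane, \<open>V3\<close> from the boost, \<open>V4\<close> from the
  dilatation; \<open>V5\<close> adds multiples of the metric and \<open>V6\<close> is scalar multiplication.
\<close>

fun V1 :: "killing \<Rightarrow> killing" where
  "V1 (A, B, C, \<alpha>, \<beta>, \<gamma>) = (0, - 2 * \<beta>, - \<alpha>, 0, - \<gamma>, 0)"

fun V2 :: "killing \<Rightarrow> killing" where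
  "V2 (A, B, C, \<alpha>, \<beta>, \<gamma>) = (- 2 * \<alpha>, 0, - \<beta>, - \<gamma>, 0, 0)"

fun V3 :: "killing \<Rightarrow> killing" where
  "V3 (A, B, C, \<alpha>, \<beta>, \<gamma>) = (2 * C, 2 * C, A + B, \<beta>, \<alpha>, 0)"

fun V4 :: "killing \<Rightarrow> killing" where
  "V4 (A, B, C, \<alpha>, \<beta>, \<gamma>) = (2 * A, 2 * B, 2 * C, \<alpha>, \<beta>, 0)"

fun V5 :: "killing \<Rightarrow> killing" where
  "V5 (A, B, C, \<alpha>, \<beta>, \<gamma>) = (1, - 1, 0, 0, 0, 0)"

fun V6 :: "killing \<Rightarrow> killing" where
  "V6 (A, B, C, \<alpha>, \<beta>, \<gamma>) = (A, B, C, \<alpha>, \<beta>, \<gamma>)"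

fun R0 :: "killing \<Rightarrow> killing" where
  "R0 (A, B, C, \<alpha>, \<beta>, \<gamma>) = (- A, - B, - C, - \<alpha>, - \<beta>, - \<gamma>)"

fun R1 :: "killing \<Rightarrow> killing" where
  "R1 (A, B, C, \<alpha>, \<beta>, \<gamma>) = (A, B, - C, - \<alpha>, \<beta>, \<gamma>)"

fun R2 :: "killing \<Rightarrow> killing" where
  "R2 (A, B, C, \<alpha>, \<beta>, \<gamma>) = (A, B, - C, \<alpha>, - \<beta>, \<gamma>)"

text \<open>
  The (global) flow of a vector field: the one-parameter group of transformations whose
  trajectories are the integral curves of the field. Each of the fields above is affine,
  hence complete, so its flow exists for all times and is unique.
\<close>

definition is_flow :: "('a::real_normed_vector \<Rightarrow> 'a) \<Rightarrow> (real \<Rightarrow> 'a \<Rightarrow> 'a) \<Rightarrow> bool" where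
  "is_flow V \<Phi> \<longleftrightarrow>
     (\<forall>p. \<Phi> 0 p = p) \<and>
     (\<forall>s t p. \<Phi> (s + t) p = \<Phi> s (\<Phi> t p)) \<and>
     (\<forall>t p. ((\<lambda>s. \<Phi> s p) has_vector_derivative V (\<Phi> t p)) (at t))"

definition GM_generators :: "(killing \<Rightarrow> killing) set" where
  "GM_generators =
     {\<Phi> t |V \<Phi> t. V \<in> {V1, V2, V3, V4, V5, V6} \<and> is_flow V \<Phi>} \<union> {R0, R1, R2}"

definition GM :: "(killing \<Rightarrow> killing) monoid" where
  "GM = (BijGroup UNIV)\<lparr>carrier := generate (BijGroup UNIV) GM_generators\<rparr>"

definition S1 :: "killing set" where
  "S1 = {(A, B, C, \<alpha>, \<beta>, \<gamma>). \<gamma> = 0}"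

definition S3 :: "killing set" where
  "S3 = {(A, B, C, \<alpha>, \<beta>, \<gamma>). \<gamma> * (A + B) = \<alpha>\<^sup>2 + \<beta>\<^sup>2 \<and> \<gamma> * C = \<alpha> * \<beta>}"

lemma is_flow_bij:
  assumes "is_flow V \<Phi>"
  shows "bij (\<Phi> t)"
proof (rule o_bij)
  show "\<Phi> (- t) \<circ> \<Phi> t = id" "\<Phi> t \<circ> \<Phi> (- t) = id"
    using assms unfolding is_flow_def fun_eq_iff o_def id_def
    by (metis add.left_inverse, metis add.right_inverse)
qed

lemma GM_generators_subset: "GM_generators \<subseteq> carrier (BijGroup UNIV)"
proof -
  have "bij R0" "bij R1" "bij R2"
    by (rule o_bij[where g = R0] o_bij[where g = R1] o_bij[where g = R2]; force)+
  then show ?thesis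
    by (auto simp: GM_generators_def BijGroup_def Bij_def dest: is_flow_bij)
qed

lemma group_action_GM: "group_action GM UNIV (\<lambda>g. g)"
proof -
  have sub: "subgroup (generate (BijGroup UNIV) GM_generators) (BijGroup UNIV)"
    by (rule group.generate_is_subgroup[OF group_BijGroup GM_generators_subset])
  have "group GM"
    unfolding GM_def by (rule subgroup.subgroup_is_group[OF sub group_BijGroup])
  moreover have "(\<lambda>g. g) \<in> hom GM (BijGroup UNIV)"
    using subgroup.subset[OF sub] by (auto simp: GM_def hom_def)
  ultimately show ?thesis
    unfolding group_action_def group_hom_def group_hom_axioms_def
    by (simp add: group_BijGroup)
qed

end

theory Submission
  imports Defs
begin

text \<open>
  Let \<open>N = x \<partial>\<^sub>t + t \<partial>\<^sub>x\<close> be the infinitesimal boost about the origin. Its square \<open>N \<otimes> N\<close> is the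
  Killing tensor \<open>(0, 0, 0, 0, 0, 1)\<close>, and the boost about a point \<open>(t0, x0)\<close> is obtained by
  translating it. The two equations of \<open>S3\<close> say, when \<open>\<gamma> \<noteq> 0\<close>, exactly that the tensor is
  \<open>a g + \<gamma> N' \<otimes> N'\<close>, where \<open>N'\<close> is the boost about \<open>(t0, x0) = (- \<beta> / \<gamma>, - \<alpha> / \<gamma>)\<close> and \<open>g\<close> is
  the metric (lemma \<open>S3_minus_S1_eq\<close>). So \<open>S3 - S1\<close> is parametrised by \<open>a\<close>, \<open>t0\<close>, \<open>x0\<close> and
  \<open>\<gamma> \<noteq> 0\<close>, and everything follows from this.

  The two components are given by the sign of \<open>\<gamma>\<close>: each half is a continuous image of a convex
  parameter set, and no connected set on which \<open>\<gamma>\<close> does not vanish meets both halves.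

  The parametrisation is realised by the group: from \<open>N \<otimes> N\<close>, the flow of \<open>V6\<close> produces every
  \<open>\<gamma> > 0\<close>, that of \<open>V5\<close> adds \<open>a g\<close>, those of \<open>V1\<close> and \<open>V2\<close> translate the centre to \<open>(t0, x0)\<close>,
  and \<open>R0\<close> reaches the tensors with \<open>\<gamma> < 0\<close>. Hence \<open>S3 - S1\<close> lies in one orbit.

  Conversely the group preserves \<open>S3 - S1\<close>. For \<open>e = 1\<close> and \<open>e = - 1\<close>, evaluating the tensor twice
  on the null covector \<open>dt + e dx\<close> gives a quadratic polynomial in the null coordinate \<open>x + e t\<close>,
  and \<open>S3\<close> is where both discriminants vanish. Along each of the six vector fields, \<open>\<gamma>\<close> and the
  two discriminants each satisfy an equation \<open>f' = k f\<close> with constant \<open>k\<close>, so that \<open>f\<close> vanishes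
  either everywhere or nowhere on an integral curve (lemma \<open>relative_invariant_iff\<close>).
\<close>

section \<open>Tensors with a centre\<close>

fun gam :: "killing \<Rightarrow> real" where
  "gam (A, B, C, \<alpha>, \<beta>, \<gamma>) = \<gamma>"

lemma gam_eq: "gam p = snd (snd (snd (snd (snd p))))"
  by (cases p rule: gam.cases) simp

lemma continuous_on_gam [continuous_intros]: "continuous_on S gam"
  unfolding gam_eq[abs_def] by (intro continuous_intros)

text \<open>
  The tensor \<open>a g + \<gamma> N' \<otimes> N'\<close> with \<open>N' = (x - x0) \<partial>\<^sub>t + (t - t0) \<partial>\<^sub>x\<close>, written out in coordinates.
\<close>

fun centred :: "real \<times> real \<times> real \<times> real \<Rightarrow> killing" where
  "centred (a, t0, x0, \<gamma>) =
     (a + \<gamma> * x0\<^sup>2, - a + \<gamma> * t0\<^sup>2, \<gamma> * t0 * x0, - \<gamma> * x0, - \<gamma> * t0, \<gamma>)"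

lemma continuous_on_centred: "continuous_on S centred"
proof -
  have eq: "centred = (\<lambda>(a, t0, x0, \<gamma>).
     (a + \<gamma> * x0\<^sup>2, - a + \<gamma> * t0\<^sup>2, \<gamma> * t0 * x0, - \<gamma> * x0, - \<gamma> * t0, \<gamma>))"
    by auto
  show ?thesis
    unfolding eq split_beta by (intro continuous_intros)
qed

lemma mem_S3_minus_S1:
  "(A, B, C, \<alpha>, \<beta>, \<gamma>) \<in> S3 - S1 \<longleftrightarrow>
     \<gamma> * (A + B) = \<alpha>\<^sup>2 + \<beta>\<^sup>2 \<and> \<gamma> * C = \<alpha> * \<beta> \<and> \<gamma> \<noteq> 0"
  by (simp add: S1_def S3_def)

lemma gam_nonzero: "p \<in> S3 - S1 \<Longrightarrow> gam p \<noteq> 0"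
  by (cases p rule: gam.cases) (simp add: mem_S3_minus_S1 del: Diff_iff)

text \<open>
  The first equation of \<open>S3\<close> allows both \<open>A\<close> and \<open>B\<close> to be matched by a single \<open>a\<close>, and the second
  forces \<open>C\<close> to be the mixed component of the square.
\<close>

lemma S3_minus_S1_eq: "S3 - S1 = centred ` {(a, t0, x0, \<gamma>). \<gamma> \<noteq> 0}"
proof (intro subset_antisym subsetI)
  fix p assume p: "p \<in> S3 - S1"
  obtain A B C \<alpha> \<beta> \<gamma> where p_eq: "p = (A, B, C, \<alpha>, \<beta>, \<gamma>)"
    by (cases p rule: gam.cases)
  have h: "\<gamma> * (A + B) = \<alpha>\<^sup>2 + \<beta>\<^sup>2" "\<gamma> * C = \<alpha> * \<beta>" "\<gamma> \<noteq> 0"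
    using p unfolding p_eq mem_S3_minus_S1 by auto
  have "B = - (A - \<gamma> * (\<alpha> / \<gamma>)\<^sup>2) + \<gamma> * (\<beta> / \<gamma>)\<^sup>2"
    using h(1,3) by (simp add: field_simps power2_eq_square)
  moreover have "C = \<gamma> * (\<beta> / \<gamma>) * (\<alpha> / \<gamma>)"
    using h(2,3) by (simp add: field_simps)
  ultimately have "p = centred (A - \<gamma> * (\<alpha> / \<gamma>)\<^sup>2, - \<beta> / \<gamma>, - \<alpha> / \<gamma>, \<gamma>)"
    using h(3) by (simp add: p_eq)
  then show "p \<in> centred ` {(a, t0, x0, \<gamma>). \<gamma> \<noteq> 0}"
    by (rule image_eqI) (use h(3) in simp)
next
  fix p assume "p \<in> centred ` {(a, t0, x0, \<gamma>). \<gamma> \<noteq> 0}"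
  then show "p \<in> S3 - S1"
    by (clarsimp simp: S1_def S3_def) (simp add: power2_eq_square algebra_simps)
qed

section \<open>Connected components\<close>

lemma connected_centred_image:
  assumes "convex I"
  shows "connected (centred ` {(a, t0, x0, \<gamma>). \<gamma> \<in> I})"
proof -
  have "{(a, t0, x0, \<gamma>). \<gamma> \<in> I} = (UNIV :: real set) \<times> (UNIV :: real set) \<times> (UNIV :: real set) \<times> I"
    by auto
  then have "convex {(a::real, t0::real, x0::real, \<gamma>). \<gamma> \<in> I}"
    using assms by (simp add: convex_Times)
  then show ?thesis
    by (intro connected_continuous_image continuous_on_centred convex_connected)
qed

text \<open>
  A nowhere vanishing continuous function has constant sign on every connected set, so a sign
  class that happens to be connected cannot be enlarged to a bigger connected set.
\<close>

lemma components_by_sign: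
  fixes f :: "'a::topological_space \<Rightarrow> real"
  assumes cont: "continuous_on S f"
    and nz: "\<And>x. x \<in> S \<Longrightarrow> f x \<noteq> 0"
    and conn: "connected {x \<in> S. f x > 0}" "connected {x \<in> S. f x < 0}"
    and ne: "{x \<in> S. f x > 0} \<noteq> {}" "{x \<in> S. f x < 0} \<noteq> {}"
  shows "components S = {{x \<in> S. f x > 0}, {x \<in> S. f x < 0}}"
    (is "_ = {?U, ?W}")
proof -
  have side: "c \<subseteq> ?U \<or> c \<subseteq> ?W" if c: "connected c" "c \<subseteq> S" for c
  proof (rule ccontr)
    assume "\<not> ?thesis"
    then obtain x y where xy: "x \<in> c" "y \<in> c" "f x < 0" "f y > 0"
      using nz c(2) by (smt (verit) mem_Collect_eq subset_iff)
    have "connected (f ` c)"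
      using c cont by (meson connected_continuous_image continuous_on_subset)
    then have "0 \<in> f ` c"
      by (rule connectedD_interval[of _ "f x" "f y"]) (use xy in auto)
    then show False
      using nz c(2) by force
  qed
  have disj: "?U \<inter> ?W = {}" by auto
  have maximal: "P \<in> components S"
    if P: "connected P" "P \<noteq> {}" "P \<in> {?U, ?W}" for P
  proof -
    have "d = P" if d: "d \<noteq> {}" "P \<subseteq> d" "connected d" "d \<subseteq> S" for d
      using side[OF d(3,4)] d(2) P(2,3) disj by blast
    then show ?thesis
      using P unfolding in_components_maximal by blast
  qed
  have "?U \<in> components S" "?W \<in> components S"
    using maximal conn ne by auto
  moreover have "c \<in> {?U, ?W}" if c: "c \<in> components S" for c
  proof -
    have "c \<noteq> {}" "c \<subseteq> S"
      using in_components_nonempty[OF c] in_components_subset[OF c] by auto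
    then obtain x where x: "x \<in> c" "x \<in> S" by blast
    then have "x \<in> ?U \<or> x \<in> ?W"
      using nz by force
    then show ?thesis
      using x c calculation components_nonoverlap by blast
  qed
  ultimately show ?thesis by blast
qed

lemma R0_R0 [simp]: "R0 (R0 p) = p"
  by (cases p rule: gam.cases) simp

lemma gam_R0 [simp]: "gam (R0 p) = - gam p"
  by (cases p rule: gam.cases) simp

lemma R0_centred: "R0 (centred (a, t0, x0, \<gamma>)) = centred (- a, t0, x0, - \<gamma>)"
  by simp

lemma R0_mem_iff [simp]: "R0 p \<in> S3 - S1 \<longleftrightarrow> p \<in> S3 - S1"
  by (cases p rule: gam.cases)
    (simp only: R0.simps mem_S3_minus_S1, auto simp: algebra_simps)

lemma R0_image_positive:
  "R0 ` {p \<in> S3 - S1. gam p > 0} = {p \<in> S3 - S1. gam p < 0}" (is "R0 ` ?U = ?W")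
proof -
  have to_W: "R0 p \<in> ?W" if "p \<in> ?U" for p
    using that by (simp only: mem_Collect_eq R0_mem_iff gam_R0 neg_less_0_iff_less)
  have to_U: "R0 p \<in> ?U" if "p \<in> ?W" for p
    using that by (simp only: mem_Collect_eq R0_mem_iff gam_R0 neg_0_less_iff_less)
  show ?thesis
  proof (rule subset_antisym)
    show "R0 ` ?U \<subseteq> ?W"
      by (rule image_subsetI) (rule to_W)
    show "?W \<subseteq> R0 ` ?U"
    proof (rule subsetI)
      fix p assume "p \<in> ?W"
      then have "R0 (R0 p) \<in> R0 ` ?U"
        by (intro imageI to_U)
      then show "p \<in> R0 ` ?U"
        by (simp only: R0_R0)
    qed
  qed
qed

lemma S3_minus_S1_positive_eq:
  "{p \<in> S3 - S1. gam p > 0} = centred ` {(a, t0, x0, \<gamma>). \<gamma> \<in> {0<..}}"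
  unfolding S3_minus_S1_eq by force

lemma components_S3_minus_S1:
  "components (S3 - S1) = {{p \<in> S3 - S1. gam p > 0}, {p \<in> S3 - S1. gam p < 0}}"
proof (rule components_by_sign)
  show "continuous_on (S3 - S1) gam" by (rule continuous_on_gam)
  show conn: "connected {p \<in> S3 - S1. gam p > 0}"
    unfolding S3_minus_S1_positive_eq by (rule connected_centred_image) simp
  have "R0 = uminus" by (auto simp: fun_eq_iff)
  then have "continuous_on {p \<in> S3 - S1. gam p > 0} R0"
    using continuous_on_minus[OF continuous_on_id] by (simp only:)
  from connected_continuous_image[OF this conn]
  show "connected {p \<in> S3 - S1. gam p < 0}"
    unfolding R0_image_positive .
  have "centred (0, 0, 0, 1) \<in> {p \<in> S3 - S1. gam p > 0}"
    by (simp add: mem_S3_minus_S1 del: Diff_iff)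
  then show "{p \<in> S3 - S1. gam p > 0} \<noteq> {}" by blast
  then show "{p \<in> S3 - S1. gam p < 0} \<noteq> {}"
    unfolding R0_image_positive[symmetric] image_is_empty .
qed (rule gam_nonzero)

section \<open>Invariance under the group\<close>

text \<open>
  When \<open>e\<^sup>2 = 1\<close>, a tensor \<open>K\<close> satisfies
  \<open>K\<^sup>1\<^sup>1 + 2 e K\<^sup>1\<^sup>2 + K\<^sup>2\<^sup>2 = (A + B + 2 e C) + 2 (\<alpha> + e \<beta>) u + \<gamma> u\<^sup>2\<close> with \<open>u = x + e t\<close>. The following
  function is the determinant of this quadratic form, that is \<open>- 1 / 4\<close> of its discriminant.
  Translations shift \<open>u\<close>, the boost and the dilatation rescale it, and the metric does not
  contribute because \<open>dt + e dx\<close> is null: this is why the vanishing of the determinant is invariant.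
\<close>

fun null_det :: "real \<Rightarrow> killing \<Rightarrow> real" where
  "null_det e (A, B, C, \<alpha>, \<beta>, \<gamma>) = \<gamma> * (A + B + 2 * e * C) - (\<alpha> + e * \<beta>)\<^sup>2"

lemma mem_S3_minus_S1_iff_null_det:
  "p \<in> S3 - S1 \<longleftrightarrow> null_det 1 p = 0 \<and> null_det (- 1) p = 0 \<and> gam p \<noteq> 0"
proof -
  obtain A B C \<alpha> \<beta> \<gamma> where p: "p = (A, B, C, \<alpha>, \<beta>, \<gamma>)"
    by (cases p rule: gam.cases)
  \<comment> \<open>Half the sum and a quarter of the difference of the two functions are the equations of \<open>S3\<close>.\<close>
  have "null_det 1 p + null_det (- 1) p = 2 * (\<gamma> * (A + B) - (\<alpha>\<^sup>2 + \<beta>\<^sup>2))"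
    "null_det 1 p - null_det (- 1) p = 4 * (\<gamma> * C - \<alpha> * \<beta>)"
    by (simp_all add: p power2_eq_square algebra_simps)
  then have "null_det 1 p = 0 \<and> null_det (- 1) p = 0 \<longleftrightarrow>
      \<gamma> * (A + B) = \<alpha>\<^sup>2 + \<beta>\<^sup>2 \<and> \<gamma> * C = \<alpha> * \<beta>"
    by argo
  moreover have "gam p = \<gamma>"
    by (simp add: p)
  ultimately show ?thesis
    using mem_S3_minus_S1[of A B C \<alpha> \<beta> \<gamma>, folded p] by metis
qed

text \<open>The function is \<open>f 0 * exp (k t)\<close>, and the exponential has no zero.\<close>

lemma exponential_growth_zero_iff:
  fixes f :: "real \<Rightarrow> real"
  assumes "\<And>t. (f has_real_derivative k * f t) (at t)"
  shows "f t = 0 \<longleftrightarrow> f 0 = 0"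
proof -
  have "((\<lambda>t. f t * exp (- k * t)) has_real_derivative 0) (at t)" for t
    by (rule derivative_eq_intros assms refl | simp add: algebra_simps)+
  then have "f t * exp (- k * t) = f 0 * exp (- k * 0)"
    by (intro DERIV_isconst_all) auto
  then show ?thesis by auto
qed

text \<open>
  The generators of the group are given by arbitrary flows of the fields. Arguing from the
  differential equation of a trajectory alone covers them without solving it.
\<close>

lemma relative_invariant_iff:
  assumes c: "\<And>t. (c has_vector_derivative V (c t)) (at t)"
    and V: "V \<in> {V1, V2, V3, V4, V5, V6}"
  shows "gam (c t) = 0 \<longleftrightarrow> gam (c 0) = 0"
    and "e\<^sup>2 = 1 \<Longrightarrow> null_det e (c t) = 0 \<longleftrightarrow> null_det e (c 0) = 0"
proof -
  define A B C a b g where coords: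
    "A = (\<lambda>s. fst (c s))" "B = (\<lambda>s. fst (snd (c s)))" "C = (\<lambda>s. fst (snd (snd (c s))))"
    "a = (\<lambda>s. fst (snd (snd (snd (c s)))))" "b = (\<lambda>s. fst (snd (snd (snd (snd (c s))))))"
    "g = (\<lambda>s. snd (snd (snd (snd (snd (c s))))))"
  have c_eq: "c s = (A s, B s, C s, a s, b s, g s)" for s
    by (simp add: coords)
  have lin: "((\<lambda>s. L (c s)) has_real_derivative L (V (c s))) (at s)"
    if "bounded_linear L" for L :: "killing \<Rightarrow> real" and s
    using bounded_linear.has_vector_derivative[OF that c[of s]]
    by (simp add: has_real_derivative_iff_has_vector_derivative)
  have bl: "bounded_linear (\<lambda>p::killing. fst p)"
    "bounded_linear (\<lambda>p::killing. fst (snd p))"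
    "bounded_linear (\<lambda>p::killing. fst (snd (snd p)))"
    "bounded_linear (\<lambda>p::killing. fst (snd (snd (snd p))))"
    "bounded_linear (\<lambda>p::killing. fst (snd (snd (snd (snd p)))))"
    "bounded_linear (\<lambda>p::killing. snd (snd (snd (snd (snd p)))))"
    by (intro bounded_linear_fst_comp bounded_linear_snd_comp
        bounded_linear_fst bounded_linear_snd)+
  note d = bl[THEN lin, folded coords, unfolded c_eq]
  have "\<exists>k. \<forall>s. (g has_real_derivative k * g s) (at s)"
  proof -
    consider "V \<in> {V1, V2, V3, V4, V5}" | "V = V6" using V by auto
    then show ?thesis
    proof cases
      case 1
      then have "\<forall>s. (g has_real_derivative 0 * g s) (at s)"
        using d(6) by auto
      then show ?thesis by blast
    next
      case 2
      then have "\<forall>s. (g has_real_derivative 1 * g s) (at s)"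
        using d(6) by simp
      then show ?thesis by blast
    qed
  qed
  then show "gam (c t) = 0 \<longleftrightarrow> gam (c 0) = 0"
    using exponential_growth_zero_iff[of g] by (auto simp: c_eq)
  assume e: "e\<^sup>2 = 1"
  let ?I = "\<lambda>s. g s * (A s + B s + 2 * e * C s) - (a s + e * b s)\<^sup>2"
  let ?D = "\<lambda>s. g s * (fst (V (c s)) + fst (snd (V (c s))) + 2 * e * fst (snd (snd (V (c s)))))
     + snd (snd (snd (snd (snd (V (c s)))))) * (A s + B s + 2 * e * C s)
     - 2 * (a s + e * b s) *
        (fst (snd (snd (snd (V (c s))))) + e * fst (snd (snd (snd (snd (V (c s)))))))"
  have D: "(?I has_real_derivative ?D s) (at s)" for s
    by (rule DERIV_cong, (rule derivative_intros d)+) (simp add: c_eq algebra_simps)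
  have unit: "e = 1 \<or> e = - 1"
    using e by (simp add: power2_eq_1_iff)
  \<comment> \<open>The boost acts on the two functions with opposite weights \<open>2 e\<close>; the dilatation and the
    scalar multiplication scale both by \<open>2\<close>.\<close>
  have "\<forall>s. ?D s = (2 * e) * ?I s" if "V = V3"
    using unit that by (auto simp: c_eq power2_eq_square algebra_simps)
  moreover have "\<forall>s. ?D s = 2 * ?I s" if "V \<in> {V4, V6}"
    using unit that by (auto simp: c_eq power2_eq_square algebra_simps)
  moreover have "\<forall>s. ?D s = 0 * ?I s" if "V \<in> {V1, V2, V5}"
    using unit that by (auto simp: c_eq power2_eq_square algebra_simps)
  ultimately obtain k where "?D s = k * ?I s" for s
    using V by blast
  then have "(?I has_real_derivative k * ?I s) (at s)" for s
    using D[of s] by simp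
  then show "null_det e (c t) = 0 \<longleftrightarrow> null_det e (c 0) = 0"
    using exponential_growth_zero_iff[of ?I k t] by (simp add: c_eq)
qed

text \<open>
  In the three lemmas below membership is an equivalence rather than an implication, so that the
  inverses in the generated group come for free.
\<close>

lemma flow_mem_iff:
  assumes "V \<in> {V1, V2, V3, V4, V5, V6}" "is_flow V \<Phi>"
  shows "\<Phi> t p \<in> S3 - S1 \<longleftrightarrow> p \<in> S3 - S1"
proof -
  have d: "((\<lambda>s. \<Phi> s p) has_vector_derivative V (\<Phi> s p)) (at s)" for s
    using assms(2) unfolding is_flow_def by blast
  have "\<Phi> 0 p = p"
    using assms(2) unfolding is_flow_def by blast
  then show ?thesis
    using relative_invariant_iff(1)[OF d assms(1), of t]
      relative_invariant_iff(2)[OF d assms(1), of 1 t]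
      relative_invariant_iff(2)[OF d assms(1), of "- 1" t]
    unfolding mem_S3_minus_S1_iff_null_det by simp
qed

lemma generator_mem_iff:
  assumes "g \<in> GM_generators"
  shows "g p \<in> S3 - S1 \<longleftrightarrow> p \<in> S3 - S1"
proof -
  obtain A B C \<alpha> \<beta> \<gamma> where p: "p = (A, B, C, \<alpha>, \<beta>, \<gamma>)"
    by (cases p rule: gam.cases)
  have R: "R1 p \<in> S3 - S1 \<longleftrightarrow> p \<in> S3 - S1" "R2 p \<in> S3 - S1 \<longleftrightarrow> p \<in> S3 - S1"
    unfolding p R1.simps R2.simps mem_S3_minus_S1 by simp_all
  consider V \<Phi> t where "g = \<Phi> t" "V \<in> {V1, V2, V3, V4, V5, V6}" "is_flow V \<Phi>"
    | "g \<in> {R0, R1, R2}"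
    using assms unfolding GM_generators_def by blast
  then show ?thesis
  proof cases
    case 1
    then show ?thesis using flow_mem_iff by metis
  next
    case 2
    then show ?thesis using R R0_mem_iff by (elim insertE emptyE) simp_all
  qed
qed

lemma GM_mem_iff:
  assumes "g \<in> carrier GM"
  shows "g p \<in> S3 - S1 \<longleftrightarrow> p \<in> S3 - S1"
proof -
  have "g \<in> generate (BijGroup UNIV) GM_generators"
    using assms by (simp add: GM_def)
  then show ?thesis
  proof (induction arbitrary: p)
    case one
    then show ?case by (simp add: BijGroup_def)
  next
    case (incl h)
    then show ?case by (rule generator_mem_iff)
  next
    case (inv h)
    then have h: "h \<in> Bij UNIV"
      using GM_generators_subset by (auto simp: BijGroup_def)
    have "h ((inv\<^bsub>BijGroup UNIV\<^esub> h) p) = p"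
      using h by (simp add: inv_BijGroup Bij_def bij_betw_def surj_f_inv_f)
    then show ?case
      using generator_mem_iff[OF inv] by metis
  next
    case (eng h1 h2)
    have "h1 \<in> Bij UNIV" "h2 \<in> Bij UNIV"
      using eng(1,2) group.generate_incl[OF group_BijGroup GM_generators_subset]
      by (auto simp: BijGroup_def)
    then have "(h1 \<otimes>\<^bsub>BijGroup UNIV\<^esub> h2) p = h1 (h2 p)"
      by (simp add: BijGroup_def compose_def)
    then show ?case using eng.IH by simp
  qed
qed

section \<open>Transitivity\<close>

text \<open>
  These four flows move the four parameters of \<open>centred\<close>: \<open>V1\<close> and \<open>V2\<close> the centre, \<open>V5\<close> the multiple
  of the metric, \<open>V6\<close> the scale. The translations move \<open>\<alpha>\<close> and \<open>\<beta>\<close> at constant speed, which integrates to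
  quadratic terms in \<open>A\<close> and \<open>B\<close>.
\<close>

lemma is_flow_V1:
  "is_flow V1 (\<lambda>t (A, B, C, \<alpha>, \<beta>, \<gamma>).
     (A, B - 2 * \<beta> * t + \<gamma> * t\<^sup>2, C - \<alpha> * t, \<alpha>, \<beta> - \<gamma> * t, \<gamma>))"
proof (unfold is_flow_def, intro conjI allI, goal_cases)
  case (1 p)
  show ?case by (cases p rule: gam.cases) simp
next
  case (2 s t p)
  show ?case by (cases p rule: gam.cases) (simp add: algebra_simps power2_eq_square)
next
  case (3 t p)
  obtain A B C \<alpha> \<beta> \<gamma> where p: "p = (A, B, C, \<alpha>, \<beta>, \<gamma>)"
    by (cases p rule: gam.cases)
  show ?case
    unfolding p prod.case V1.simps
    by (intro has_vector_derivative_Pair;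
        unfold has_real_derivative_iff_has_vector_derivative[symmetric];
        (rule derivative_eq_intros refl | simp)+)
qed

lemma is_flow_V2:
  "is_flow V2 (\<lambda>t (A, B, C, \<alpha>, \<beta>, \<gamma>).
     (A - 2 * \<alpha> * t + \<gamma> * t\<^sup>2, B, C - \<beta> * t, \<alpha> - \<gamma> * t, \<beta>, \<gamma>))"
proof (unfold is_flow_def, intro conjI allI, goal_cases)
  case (1 p)
  show ?case by (cases p rule: gam.cases) simp
next
  case (2 s t p)
  show ?case by (cases p rule: gam.cases) (simp add: algebra_simps power2_eq_square)
next
  case (3 t p)
  obtain A B C \<alpha> \<beta> \<gamma> where p: "p = (A, B, C, \<alpha>, \<beta>, \<gamma>)"
    by (cases p rule: gam.cases)
  show ?case
    unfolding p prod.case V2.simps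
    by (intro has_vector_derivative_Pair;
        unfold has_real_derivative_iff_has_vector_derivative[symmetric];
        (rule derivative_eq_intros refl | simp)+)
qed

lemma is_flow_V5:
  "is_flow V5 (\<lambda>t (A, B, C, \<alpha>, \<beta>, \<gamma>). (A + t, B - t, C, \<alpha>, \<beta>, \<gamma>))"
proof (unfold is_flow_def, intro conjI allI, goal_cases)
  case (1 p)
  show ?case by (cases p rule: gam.cases) simp
next
  case (2 s t p)
  show ?case by (cases p rule: gam.cases) (simp add: algebra_simps)
next
  case (3 t p)
  obtain A B C \<alpha> \<beta> \<gamma> where p: "p = (A, B, C, \<alpha>, \<beta>, \<gamma>)"
    by (cases p rule: gam.cases)
  show ?case
    unfolding p prod.case V5.simps
    by (intro has_vector_derivative_Pair;
        unfold has_real_derivative_iff_has_vector_derivative[symmetric];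
        (rule derivative_eq_intros refl | simp)+)
qed

lemma is_flow_V6: "is_flow V6 (\<lambda>t p. exp t *\<^sub>R p)"
proof (unfold is_flow_def, intro conjI allI, goal_cases)
  case (3 t p)
  have "((\<lambda>s. exp s *\<^sub>R p) has_vector_derivative exp t *\<^sub>R p) (at t)"
    by (rule has_vector_derivative_scaleR[OF DERIV_exp has_vector_derivative_const, simplified])
  moreover have "V6 q = q" for q
    by (cases q rule: gam.cases) simp
  ultimately show ?case by metis
qed (simp_all add: exp_add del: scaleR_Pair)

lemma orbit_closed_under_generator:
  assumes "q \<in> orbit GM (\<lambda>g. g) p" "h \<in> GM_generators"
  shows "h q \<in> orbit GM (\<lambda>g. g) p"
proof -
  obtain g where g: "g \<in> carrier GM" "q = g p"
    using assms(1) by (auto simp: orbit_def)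
  have h: "h \<in> carrier GM"
    using assms(2) by (simp add: GM_def generate.incl)
  have "h \<in> Bij UNIV" "g \<in> Bij UNIV"
    using g(1) h group.generate_incl[OF group_BijGroup GM_generators_subset]
    by (auto simp: BijGroup_def GM_def)
  then have "h q = (h \<otimes>\<^bsub>GM\<^esub> g) p"
    by (simp add: GM_def BijGroup_def compose_def g(2))
  moreover have "h \<otimes>\<^bsub>GM\<^esub> g \<in> carrier GM"
    using g(1) h by (simp add: GM_def generate.eng)
  ultimately show ?thesis
    unfolding orbit_def by blast
qed

lemma orbit_closed_under_flow:
  assumes "q \<in> orbit GM (\<lambda>g. g) p" "is_flow V \<Phi>" "V \<in> {V1, V2, V3, V4, V5, V6}"
  shows "\<Phi> t q \<in> orbit GM (\<lambda>g. g) p"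
  using assms(1)
  by (rule orbit_closed_under_generator) (use assms(2,3) in \<open>auto simp: GM_generators_def\<close>)

lemma centred_positive_in_orbit:
  assumes "\<gamma> > 0"
  shows "centred (a, t0, x0, \<gamma>) \<in> orbit GM (\<lambda>g. g) (centred (0, 0, 0, 1))"
    (is "_ \<in> ?O")
proof -
  have "(\<lambda>p. p) \<in> carrier GM"
    using generate.one[of "BijGroup UNIV" GM_generators]
    by (simp add: GM_def BijGroup_def id_def restrict_def)
  then have "centred (0, 0, 0, 1) \<in> ?O"
    unfolding orbit_def by force
  \<comment> \<open>The scale comes first: \<open>V6\<close> would also rescale \<open>a\<close>, while \<open>V5\<close>, \<open>V1\<close> and \<open>V2\<close> leave \<open>\<gamma>\<close> alone.\<close>
  from orbit_closed_under_flow[OF this is_flow_V6, of "ln \<gamma>"]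
  have "(0, 0, 0, 0, 0, \<gamma>) \<in> ?O"
    using assms by simp
  from orbit_closed_under_flow[OF this is_flow_V5, of a]
  have "(a, - a, 0, 0, 0, \<gamma>) \<in> ?O"
    by simp
  from orbit_closed_under_flow[OF this is_flow_V1, of t0]
  have "(a, - a + \<gamma> * t0\<^sup>2, 0, 0, - \<gamma> * t0, \<gamma>) \<in> ?O"
    by simp
  from orbit_closed_under_flow[OF this is_flow_V2, of x0]
  show ?thesis
    by (simp add: algebra_simps)
qed

lemma orbit_eq_S3_minus_S1: "orbit GM (\<lambda>g. g) (centred (0, 0, 0, 1)) = S3 - S1"
proof (intro subset_antisym subsetI)
  fix p assume "p \<in> orbit GM (\<lambda>g. g) (centred (0, 0, 0, 1))"
  moreover have "centred (0, 0, 0, 1) \<in> S3 - S1"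
    by (simp add: mem_S3_minus_S1 del: Diff_iff)
  ultimately show "p \<in> S3 - S1"
    using GM_mem_iff unfolding orbit_def by blast
next
  fix p assume "p \<in> S3 - S1"
  then obtain a t0 x0 \<gamma> where p: "p = centred (a, t0, x0, \<gamma>)" "\<gamma> \<noteq> 0"
    unfolding S3_minus_S1_eq by auto
  show "p \<in> orbit GM (\<lambda>g. g) (centred (0, 0, 0, 1))"
  proof (cases "\<gamma> > 0")
    case True
    then show ?thesis
      unfolding p(1) by (rule centred_positive_in_orbit)
  next
    case False
    then have "centred (- a, t0, x0, - \<gamma>) \<in> orbit GM (\<lambda>g. g) (centred (0, 0, 0, 1))"
      using p(2) by (intro centred_positive_in_orbit) simp
    then have "R0 (centred (- a, t0, x0, - \<gamma>)) \<in> orbit GM (\<lambda>g. g) (centred (0, 0, 0, 1))"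
      by (rule orbit_closed_under_generator) (simp add: GM_generators_def)
    then show ?thesis
      unfolding R0_centred p(1) by simp
  qed
qed

theorem proposition22:
  shows "(\<exists>U W. U \<noteq> W \<and> components (S3 - S1) = {U, W} \<and> R0 ` U = W \<and> R0 ` W = U) \<and>
         S3 - S1 \<in> orbits GM UNIV (\<lambda>g. g)"
proof
  let ?U = "{p \<in> S3 - S1. gam p > 0}" and ?W = "{p \<in> S3 - S1. gam p < 0}"
  have "centred (0, 0, 0, 1) \<in> ?U"
    by (simp add: mem_S3_minus_S1 del: Diff_iff)
  then have "?U \<noteq> ?W" by fastforce
  moreover have "R0 ` ?W = ?U"
    by (simp add: R0_image_positive[symmetric] image_image del: Diff_iff)
  ultimately show "\<exists>U W. U \<noteq> W \<and> components (S3 - S1) = {U, W} \<and> R0 ` U = W \<and> R0 ` W = U"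
    by (intro exI[of _ ?U] exI[of _ ?W] conjI components_S3_minus_S1 R0_image_positive)
  show "S3 - S1 \<in> orbits GM UNIV (\<lambda>g. g)"
    unfolding orbits_def using orbit_eq_S3_minus_S1 by blast
qed

end
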